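(* Let $\Omega\subset\mathbb{R}^d$ be a bounded domain, and for $n\in\mathbb{N}$ let $X_n\subset H^1_0(\Omega)^d$ and $M_n\subset L^2_\circ(\Omega)$ be finite-dimensional subspaces, with discrete inf-sup constant $$\beta_n=\inf_{q\in M_n}\ \sup_{\mathbf v\in X_n}\ \frac{\langle \operatorname{div}\mathbf v,q\rangle_\Omega}{|\mathbf v|_{1,\Omega}\,\|q\|_{0,\Omega}} .$$ Suppose that the discrete LBB condition $$\inf_{n\in\mathbb{N}}\beta_n=\beta_\star>0$$ is satisfied and that the sequence $(M_n)$ is asymptotically dense in $L^2_\circ(\Omega)$, i.e. for every $q\in L^2_\circ(\Omega)$ there exist $q_n\in M_n$ with $q_n\to q$ in $L^2(\Omega)$. Then $$\beta_\star\le\beta(\Omega).$$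
   Context: A domain is a nonempty connected open set. $L^2_\circ(\Omega)$ is the space of functions in $L^2(\Omega)$ with mean value zero; $\langle\cdot,\cdot\rangle_\Omega$ and $\|\cdot\|_{0,\Omega}$ are the $L^2(\Omega)$ scalar product and norm. $H^1_0(\Omega)$ is the closure of the smooth functions with compact support in $\Omega$ with respect to the $H^1$ seminorm; for vector functions $|\mathbf v|_{1,\Omega}=\|\nabla\mathbf v\|_{0,\Omega}=\big(\sum_{k,j=1}^d\|\partial_{x_j}v_k\|_{0,\Omega}^2\big)^{1/2}$. The inf-sup (LBB) constant of $\Omega$ is $$\beta(\Omega)=\inf_{q\in L^2_\circ(\Omega)}\ \sup_{\mathbf v\in H^1_0(\Omega)^d}\frac{\langle \operatorname{div}\mathbf v,q\rangle_\Omega}{|\mathbf v|_{1,\Omega}\,\|q\|_{0,\Omega}} .$$ Infima and suprema of quotients are over nonzero elements. *)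

theory Defs
  imports "HOL-Analysis.Analysis" "HOL-Library.Extended_Real"
begin

text \<open>Elements of the Lebesgue and Sobolev spaces are represented by functions on the whole
  space; only their restrictions to \<open>\<Omega>\<close> matter, and two functions represent the same element iff
  they agree almost everywhere on \<open>\<Omega>\<close>.\<close>

definition L2 :: "(real ^ 'd) set \<Rightarrow> (real ^ 'd \<Rightarrow> real) set" where
  "L2 \<Omega> = {f \<in> borel_measurable (lebesgue_on \<Omega>). integrable (lebesgue_on \<Omega>) (\<lambda>x. (f x)\<^sup>2)}"

definition L2_inner :: "(real ^ 'd) set \<Rightarrow> (real ^ 'd \<Rightarrow> real) \<Rightarrow> (real ^ 'd \<Rightarrow> real) \<Rightarrow> real" where
  "L2_inner \<Omega> f g = (\<integral>x. f x * g x \<partial>lebesgue_on \<Omega>)"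

definition L2_norm :: "(real ^ 'd) set \<Rightarrow> (real ^ 'd \<Rightarrow> real) \<Rightarrow> real" where
  "L2_norm \<Omega> f = sqrt (L2_inner \<Omega> f f)"

definition L2_mean_zero :: "(real ^ 'd) set \<Rightarrow> (real ^ 'd \<Rightarrow> real) set" where
  "L2_mean_zero \<Omega> = {q \<in> L2 \<Omega>. (\<integral>x. q x \<partial>lebesgue_on \<Omega>) = 0}"

definition partial :: "'d \<Rightarrow> (real ^ 'd \<Rightarrow> real) \<Rightarrow> real ^ 'd \<Rightarrow> real" where
  "partial j f x = frechet_derivative f (at x) (axis j 1)"

primrec C_k :: "nat \<Rightarrow> (real ^ 'd \<Rightarrow> real) \<Rightarrow> bool" where
  "C_k 0 f \<longleftrightarrow> continuous_on UNIV f"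
| "C_k (Suc k) f \<longleftrightarrow> (\<forall>x. f differentiable at x) \<and> (\<forall>j. C_k k (partial j f))"

definition test_functions :: "(real ^ 'd) set \<Rightarrow> (real ^ 'd \<Rightarrow> real) set" where
  "test_functions \<Omega> =
    {\<phi>. (\<forall>k. C_k k \<phi>) \<and> compact (closure {x. \<phi> x \<noteq> 0}) \<and> closure {x. \<phi> x \<noteq> 0} \<subseteq> \<Omega>}"

definition is_weak_partial ::
    "(real ^ 'd) set \<Rightarrow> 'd \<Rightarrow> (real ^ 'd \<Rightarrow> real) \<Rightarrow> (real ^ 'd \<Rightarrow> real) \<Rightarrow> bool" where
  "is_weak_partial \<Omega> j u g \<longleftrightarrow>
    (\<forall>\<phi>\<in>test_functions \<Omega>. L2_inner \<Omega> u (partial j \<phi>) = - L2_inner \<Omega> g \<phi>)"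

definition H1 :: "(real ^ 'd) set \<Rightarrow> (real ^ 'd \<Rightarrow> real) set" where
  "H1 \<Omega> = {u \<in> L2 \<Omega>. \<forall>j. \<exists>g\<in>L2 \<Omega>. is_weak_partial \<Omega> j u g}"

text \<open>A representative of the weak partial derivative, which is unique up to null sets. It is
  meaningful only for functions in \<open>H1 \<Omega>\<close>.\<close>

definition weak_partial ::
    "(real ^ 'd) set \<Rightarrow> 'd \<Rightarrow> (real ^ 'd \<Rightarrow> real) \<Rightarrow> real ^ 'd \<Rightarrow> real" where
  "weak_partial \<Omega> j u = (SOME g. g \<in> L2 \<Omega> \<and> is_weak_partial \<Omega> j u g)"

definition H1_seminorm :: "(real ^ 'd) set \<Rightarrow> (real ^ 'd \<Rightarrow> real) \<Rightarrow> real" where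
  "H1_seminorm \<Omega> u = sqrt (\<Sum>j\<in>UNIV. (L2_norm \<Omega> (weak_partial \<Omega> j u))\<^sup>2)"

text \<open>The closure of the test functions. The seminorm does not see constants, so the limit has to
  be pinned down by convergence in \<open>L2 \<Omega>\<close> as well; on a bounded \<open>\<Omega>\<close>, Poincare's inequality makes
  every seminorm-Cauchy sequence of test functions converge in \<open>L2 \<Omega>\<close>, so that this is the closure
  (completion) with respect to the seminorm.\<close>

definition H1_0 :: "(real ^ 'd) set \<Rightarrow> (real ^ 'd \<Rightarrow> real) set" where
  "H1_0 \<Omega> = {u \<in> H1 \<Omega>. \<exists>\<phi>. (\<forall>n::nat. \<phi> n \<in> test_functions \<Omega>) \<and>
      (\<lambda>n. H1_seminorm \<Omega> (\<lambda>x. u x - \<phi> n x)) \<longlonglongrightarrow> 0 \<and>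
      (\<lambda>n. L2_norm \<Omega> (\<lambda>x. u x - \<phi> n x)) \<longlonglongrightarrow> 0}"

definition H1_0_vec :: "(real ^ 'd) set \<Rightarrow> (real ^ 'd \<Rightarrow> real ^ 'd) set" where
  "H1_0_vec \<Omega> = {v. \<forall>k. (\<lambda>x. v x $ k) \<in> H1_0 \<Omega>}"

definition H1_seminorm_vec :: "(real ^ 'd) set \<Rightarrow> (real ^ 'd \<Rightarrow> real ^ 'd) \<Rightarrow> real" where
  "H1_seminorm_vec \<Omega> v =
    sqrt (\<Sum>k\<in>UNIV. \<Sum>j\<in>UNIV. (L2_norm \<Omega> (weak_partial \<Omega> j (\<lambda>x. v x $ k)))\<^sup>2)"

definition weak_div :: "(real ^ 'd) set \<Rightarrow> (real ^ 'd \<Rightarrow> real ^ 'd) \<Rightarrow> real ^ 'd \<Rightarrow> real" where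
  "weak_div \<Omega> v x = (\<Sum>j\<in>UNIV. weak_partial \<Omega> j (\<lambda>y. v y $ j) x)"

definition nonzero_on :: "(real ^ 'd) set \<Rightarrow> (real ^ 'd \<Rightarrow> 'b::zero) \<Rightarrow> bool" where
  "nonzero_on \<Omega> f \<longleftrightarrow> \<not> (AE x in lebesgue_on \<Omega>. f x = 0)"

text \<open>\<open>V\<close> is a set of representatives of a finite-dimensional space; \<open>V\<close> itself may be
  infinite-dimensional, since it may contain many representatives of the same element.\<close>

definition fin_dim_subspace :: "(real ^ 'd) set \<Rightarrow> (real ^ 'd \<Rightarrow> 'b::real_vector) set \<Rightarrow> bool" where
  "fin_dim_subspace \<Omega> V \<longleftrightarrow>
    (\<lambda>x. 0) \<in> V \<and>
    (\<forall>f\<in>V. \<forall>g\<in>V. (\<lambda>x. f x + g x) \<in> V) \<and>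
    (\<forall>c. \<forall>f\<in>V. (\<lambda>x. c *\<^sub>R f x) \<in> V) \<and>
    (\<exists>B\<subseteq>V. finite B \<and>
      (\<forall>f\<in>V. \<exists>c. AE x in lebesgue_on \<Omega>. f x = (\<Sum>b\<in>B. c b *\<^sub>R b x)))"

text \<open>The values are extended reals, so that the infimum over a trivial space \<open>M\<close> is \<open>\<infinity>\<close>.\<close>

definition inf_sup_const ::
    "(real ^ 'd) set \<Rightarrow> (real ^ 'd \<Rightarrow> real ^ 'd) set \<Rightarrow> (real ^ 'd \<Rightarrow> real) set \<Rightarrow> ereal" where
  "inf_sup_const \<Omega> X M =
    (INF q\<in>{q \<in> M. nonzero_on \<Omega> q}. SUP v\<in>{v \<in> X. nonzero_on \<Omega> v}.
      ereal (L2_inner \<Omega> (weak_div \<Omega> v) q / (H1_seminorm_vec \<Omega> v * L2_norm \<Omega> q)))"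

definition LBB_const :: "(real ^ 'd) set \<Rightarrow> ereal" where
  "LBB_const \<Omega> = inf_sup_const \<Omega> (H1_0_vec \<Omega>) (L2_mean_zero \<Omega>)"

definition asymptotically_dense ::
    "(real ^ 'd) set \<Rightarrow> (nat \<Rightarrow> (real ^ 'd \<Rightarrow> real) set) \<Rightarrow> bool" where
  "asymptotically_dense \<Omega> M \<longleftrightarrow>
    (\<forall>q\<in>L2_mean_zero \<Omega>. \<exists>p. (\<forall>n. p n \<in> M n) \<and> (\<lambda>n. L2_norm \<Omega> (\<lambda>x. p n x - q x)) \<longlonglongrightarrow> 0)"

end

theory Submission imports Defs begin

text \<open>Let \<open>q\<close> be nonzero with mean value zero and \<open>p\<close> a nearby element of \<open>M n\<close>. A velocity
  \<open>v \<in> X n\<close> that is nearly optimal for \<open>p\<close> is admissible in \<open>LBB_const\<close>, and replacing \<open>p\<close> by \<open>q\<close> in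
  its quotient costs only a multiple of \<open>\<parallel>p - q\<parallel>\<close>, uniformly in \<open>v\<close>, because the divergence is
  bounded from \<open>H1_seminorm_vec\<close> to \<open>L2_norm\<close>.\<close>

section \<open>Scalar product and norm on \<open>L2\<close>\<close>

lemma L2_integrable_mult:
  assumes "f \<in> L2 \<Omega>" "g \<in> L2 \<Omega>"
  shows "integrable (lebesgue_on \<Omega>) (\<lambda>x. f x * g x)"
proof (rule Bochner_Integration.integrable_bound)
  show "integrable (lebesgue_on \<Omega>) (\<lambda>x. (f x)\<^sup>2 + (g x)\<^sup>2)"
    using assms by (auto simp: L2_def)
  show "(\<lambda>x. f x * g x) \<in> borel_measurable (lebesgue_on \<Omega>)"
    using assms by (auto simp: L2_def)
  show "AE x in lebesgue_on \<Omega>. norm (f x * g x) \<le> norm ((f x)\<^sup>2 + (g x)\<^sup>2)"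
  proof (rule AE_I2)
    fix x
    have "2 * \<bar>f x\<bar> * \<bar>g x\<bar> \<le> (f x)\<^sup>2 + (g x)\<^sup>2"
      using sum_squares_bound[of "\<bar>f x\<bar>" "\<bar>g x\<bar>"] by simp
    moreover have "0 \<le> \<bar>f x\<bar> * \<bar>g x\<bar>" by simp
    ultimately show "norm (f x * g x) \<le> norm ((f x)\<^sup>2 + (g x)\<^sup>2)"
      unfolding real_norm_def abs_mult by linarith
  qed
qed

lemma L2_diff:
  assumes "f \<in> L2 \<Omega>" "g \<in> L2 \<Omega>"
  shows "(\<lambda>x. f x - g x) \<in> L2 \<Omega>"
  using assms L2_integrable_mult[OF assms]
  by (auto simp: L2_def power2_diff mult.assoc)

lemma L2_sum:
  assumes "\<And>i. i \<in> I \<Longrightarrow> f i \<in> L2 \<Omega>"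
  shows "(\<lambda>x. \<Sum>i\<in>I. f i x) \<in> L2 \<Omega>"
proof -
  have "integrable (lebesgue_on \<Omega>) (\<lambda>x. \<Sum>i\<in>I. \<Sum>j\<in>I. f i x * f j x)"
    using assms by (intro Bochner_Integration.integrable_sum L2_integrable_mult)
  moreover have "(\<lambda>x. \<Sum>i\<in>I. f i x) \<in> borel_measurable (lebesgue_on \<Omega>)"
    using assms by (intro borel_measurable_sum) (auto simp: L2_def)
  ultimately show ?thesis
    by (simp add: L2_def power2_eq_square sum_product)
qed

lemma L2_inner_commute: "L2_inner \<Omega> f g = L2_inner \<Omega> g f"
  by (simp add: L2_inner_def mult.commute)

lemma L2_inner_diff_left:
  assumes "f \<in> L2 \<Omega>" "g \<in> L2 \<Omega>" "h \<in> L2 \<Omega>"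
  shows "L2_inner \<Omega> (\<lambda>x. f x - g x) h = L2_inner \<Omega> f h - L2_inner \<Omega> g h"
  using assms by (simp add: L2_inner_def left_diff_distrib L2_integrable_mult)

lemma L2_inner_sum_left:
  assumes "\<And>i. i \<in> I \<Longrightarrow> f i \<in> L2 \<Omega>" "h \<in> L2 \<Omega>"
  shows "L2_inner \<Omega> (\<lambda>x. \<Sum>i\<in>I. f i x) h = (\<Sum>i\<in>I. L2_inner \<Omega> (f i) h)"
  using assms by (simp add: L2_inner_def sum_distrib_right L2_integrable_mult)

lemma L2_inner_self_nonneg: "0 \<le> L2_inner \<Omega> f f"
  by (simp add: L2_inner_def)

lemma L2_norm_nonneg: "0 \<le> L2_norm \<Omega> f"
  by (simp add: L2_norm_def L2_inner_self_nonneg)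

lemma L2_norm_square: "(L2_norm \<Omega> f)\<^sup>2 = L2_inner \<Omega> f f"
  by (simp add: L2_norm_def L2_inner_self_nonneg)

text \<open>Links the almost-everywhere condition in \<open>nonzero_on\<close> to the norm, so that
  a nonzero element has positive norm and may be divided by.\<close>

lemma L2_norm_eq_0_iff:
  assumes "f \<in> L2 \<Omega>"
  shows "L2_norm \<Omega> f = 0 \<longleftrightarrow> (AE x in lebesgue_on \<Omega>. f x = 0)"
proof -
  have "L2_norm \<Omega> f = 0 \<longleftrightarrow> (\<integral>x. f x * f x \<partial>lebesgue_on \<Omega>) = 0"
    by (simp add: L2_norm_def L2_inner_def)
  also have "\<dots> \<longleftrightarrow> (AE x in lebesgue_on \<Omega>. f x * f x = 0)"
    by (intro integral_nonneg_eq_0_iff_AE L2_integrable_mult assms) auto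
  finally show ?thesis by simp
qed

lemma L2_Cauchy_Schwarz:
  assumes f: "f \<in> L2 \<Omega>" and g: "g \<in> L2 \<Omega>"
  shows "\<bar>L2_inner \<Omega> f g\<bar> \<le> L2_norm \<Omega> f * L2_norm \<Omega> g"
proof -
  let ?a = "L2_inner \<Omega> f f" and ?b = "L2_inner \<Omega> f g" and ?c = "L2_inner \<Omega> g g"
  \<comment> \<open>The form is kept homogeneous in \<open>s\<close> and \<open>t\<close>, so that
    \<open>s = ?c\<close> can be inserted below without dividing by \<open>?c\<close>.\<close>
  have quadratic: "0 \<le> s\<^sup>2 * ?a - 2 * s * t * ?b + t\<^sup>2 * ?c" for s t
  proof -
    have "0 \<le> (\<integral>x. (s * f x - t * g x)\<^sup>2 \<partial>lebesgue_on \<Omega>)"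
      by simp
    also have "\<dots> = (\<integral>x. s\<^sup>2 * (f x * f x) - 2 * s * t * (f x * g x) + t\<^sup>2 * (g x * g x) \<partial>lebesgue_on \<Omega>)"
      by (intro Bochner_Integration.integral_cong) (auto simp: power2_eq_square algebra_simps)
    also have "\<dots> = s\<^sup>2 * ?a - 2 * s * t * ?b + t\<^sup>2 * ?c"
      using L2_integrable_mult[OF f f] L2_integrable_mult[OF f g] L2_integrable_mult[OF g g]
      by (simp add: L2_inner_def)
    finally show ?thesis .
  qed
  have "?b\<^sup>2 \<le> ?a * ?c"
  proof (cases "?c = 0")
    case True
    have "?b = 0"
    proof (rule ccontr)
      assume "?b \<noteq> 0"
      \<comment> \<open>With \<open>?c = 0\<close> the form is linear in \<open>t\<close>; this
        \<open>t\<close> gives it the value \<open>?a - (?a + 1) = -1\<close>.\<close>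
      then show False
        using quadratic[of 1 "(?a + 1) / (2 * ?b)"] True by (simp add: field_simps)
    qed
    then show ?thesis using True by simp
  next
    case False
    then have "0 < ?c" using L2_inner_self_nonneg[of \<Omega> g] by linarith
    moreover have "0 \<le> ?c * (?a * ?c - ?b\<^sup>2)"
      using quadratic[of ?c ?b] by (simp add: power2_eq_square algebra_simps)
    ultimately show ?thesis by (simp add: zero_le_mult_iff)
  qed
  then have "sqrt (?b\<^sup>2) \<le> sqrt (?a * ?c)" by (rule real_sqrt_le_mono)
  then show ?thesis by (simp add: L2_norm_def real_sqrt_mult)
qed

text \<open>Follows from Cauchy-Schwarz applied to both terms of <f,g> - <f-g,g> = <g,g>, after
  division by the norm of \<open>g\<close>. In this form it bounds the norm of an approximation
  \<open>f\<close> of \<open>g\<close> from below.\<close>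

lemma L2_norm_triangle:
  assumes f: "f \<in> L2 \<Omega>" and g: "g \<in> L2 \<Omega>"
  shows "L2_norm \<Omega> g \<le> L2_norm \<Omega> f + L2_norm \<Omega> (\<lambda>x. f x - g x)"
proof (cases "L2_norm \<Omega> g = 0")
  case True
  then show ?thesis by (simp add: L2_norm_nonneg)
next
  case False
  then have pos: "0 < L2_norm \<Omega> g" using L2_norm_nonneg[of \<Omega> g] by linarith
  have "(L2_norm \<Omega> g)\<^sup>2 = L2_inner \<Omega> f g - L2_inner \<Omega> (\<lambda>x. f x - g x) g"
    by (simp add: L2_norm_square L2_inner_diff_left f g)
  also have "\<dots> \<le> L2_norm \<Omega> f * L2_norm \<Omega> g + L2_norm \<Omega> (\<lambda>x. f x - g x) * L2_norm \<Omega> g"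
    using L2_Cauchy_Schwarz[OF f g] L2_Cauchy_Schwarz[OF L2_diff[OF f g] g] by linarith
  finally have "L2_norm \<Omega> g * L2_norm \<Omega> g
      \<le> (L2_norm \<Omega> f + L2_norm \<Omega> (\<lambda>x. f x - g x)) * L2_norm \<Omega> g"
    by (simp add: power2_eq_square algebra_simps)
  then show ?thesis using pos by simp
qed

section \<open>Weak derivatives and boundedness of the divergence\<close>

lemma weak_partial_in_L2:
  assumes "u \<in> H1 \<Omega>"
  shows "weak_partial \<Omega> j u \<in> L2 \<Omega>"
proof -
  have "\<exists>g. g \<in> L2 \<Omega> \<and> is_weak_partial \<Omega> j u g"
    using assms by (auto simp: H1_def)
  from someI_ex[OF this] show ?thesis by (simp add: weak_partial_def)
qed

lemma H1_0_vec_partial_in_L2: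
  assumes "v \<in> H1_0_vec \<Omega>"
  shows "weak_partial \<Omega> j (\<lambda>x. v x $ k) \<in> L2 \<Omega>"
  using assms by (intro weak_partial_in_L2) (simp add: H1_0_vec_def H1_0_def)

lemma H1_seminorm_vec_nonneg: "0 \<le> H1_seminorm_vec \<Omega> v"
  by (simp add: H1_seminorm_vec_def sum_nonneg)

text \<open>The left side squared is one summand of the squared seminorm. The diagonal case
  \<open>j = k\<close> controls the terms of the divergence.\<close>

lemma L2_norm_partial_le_H1_seminorm_vec:
  "L2_norm \<Omega> (weak_partial \<Omega> j (\<lambda>x. v x $ k)) \<le> H1_seminorm_vec \<Omega> v"
proof -
  let ?s = "\<lambda>k j. (L2_norm \<Omega> (weak_partial \<Omega> j (\<lambda>x. v x $ k)))\<^sup>2"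
  have "?s k j \<le> (\<Sum>j\<in>UNIV. ?s k j)"
    by (rule member_le_sum) auto
  also have "\<dots> \<le> (\<Sum>k\<in>UNIV. \<Sum>j\<in>UNIV. ?s k j)"
    by (rule member_le_sum) (auto intro: sum_nonneg)
  finally show ?thesis
    unfolding H1_seminorm_vec_def by (rule real_le_rsqrt)
qed

lemma weak_div_in_L2:
  assumes "v \<in> H1_0_vec \<Omega>"
  shows "weak_div \<Omega> v \<in> L2 \<Omega>"
  using L2_sum[of UNIV "\<lambda>j. weak_partial \<Omega> j (\<lambda>y. v y $ j)" \<Omega>] H1_0_vec_partial_in_L2[OF assms]
  by (simp add: weak_div_def[abs_def])

text \<open>The optimal constant is \<open>1\<close> instead of \<open>CARD('d)\<close>, but any bound will do.\<close>

lemma weak_div_inner_bound: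
  fixes v :: "real ^ 'd \<Rightarrow> real ^ 'd"
  assumes v: "v \<in> H1_0_vec \<Omega>" and r: "r \<in> L2 \<Omega>"
  shows "\<bar>L2_inner \<Omega> (weak_div \<Omega> v) r\<bar> \<le> real CARD('d) * H1_seminorm_vec \<Omega> v * L2_norm \<Omega> r"
proof -
  let ?p = "\<lambda>j. weak_partial \<Omega> j (\<lambda>y. v y $ j)"
  have "L2_inner \<Omega> (weak_div \<Omega> v) r = (\<Sum>j\<in>UNIV. L2_inner \<Omega> (?p j) r)"
    unfolding weak_div_def[abs_def]
    by (rule L2_inner_sum_left) (use H1_0_vec_partial_in_L2[OF v] r in auto)
  then have "\<bar>L2_inner \<Omega> (weak_div \<Omega> v) r\<bar> \<le> (\<Sum>j\<in>UNIV. \<bar>L2_inner \<Omega> (?p j) r\<bar>)"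
    by simp
  \<comment> \<open>Each diagonal derivative is estimated by the full seminorm; adding these
    estimates produces the factor \<open>CARD('d)\<close>.\<close>
  also have "\<dots> \<le> (\<Sum>j\<in>(UNIV :: 'd set). H1_seminorm_vec \<Omega> v * L2_norm \<Omega> r)"
  proof (rule sum_mono)
    fix j
    have "\<bar>L2_inner \<Omega> (?p j) r\<bar> \<le> L2_norm \<Omega> (?p j) * L2_norm \<Omega> r"
      using H1_0_vec_partial_in_L2[OF v] r by (rule L2_Cauchy_Schwarz)
    also have "\<dots> \<le> H1_seminorm_vec \<Omega> v * L2_norm \<Omega> r"
      by (intro mult_right_mono L2_norm_partial_le_H1_seminorm_vec L2_norm_nonneg)
    finally show "\<bar>L2_inner \<Omega> (?p j) r\<bar> \<le> H1_seminorm_vec \<Omega> v * L2_norm \<Omega> r" .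
  qed
  finally show ?thesis by (simp add: mult.assoc)
qed

section \<open>Passage from the discrete spaces to the full space\<close>

theorem theorem2p3:
  fixes \<Omega> :: "(real ^ 'd) set"
    and X :: "nat \<Rightarrow> (real ^ 'd \<Rightarrow> real ^ 'd) set"
    and M :: "nat \<Rightarrow> (real ^ 'd \<Rightarrow> real) set"
    and \<beta>star :: ereal
  assumes "open \<Omega>" and "connected \<Omega>" and "\<Omega> \<noteq> {}" and "bounded \<Omega>"
    and "\<And>n. X n \<subseteq> H1_0_vec \<Omega>" and "\<And>n. fin_dim_subspace \<Omega> (X n)"
    and "\<And>n. M n \<subseteq> L2_mean_zero \<Omega>" and "\<And>n. fin_dim_subspace \<Omega> (M n)"
    and "(INF n. inf_sup_const \<Omega> (X n) (M n)) = \<beta>star" and "\<beta>star > 0"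
    and "asymptotically_dense \<Omega> M"
  shows "\<beta>star \<le> LBB_const \<Omega>"
proof -
  have "\<beta>star \<le> (SUP v\<in>{v \<in> H1_0_vec \<Omega>. nonzero_on \<Omega> v}.
      ereal (L2_inner \<Omega> (weak_div \<Omega> v) q / (H1_seminorm_vec \<Omega> v * L2_norm \<Omega> q)))" (is "_ \<le> ?S")
    if q: "q \<in> L2_mean_zero \<Omega>" "nonzero_on \<Omega> q" for q
  proof (rule ccontr)
    assume "\<not> \<beta>star \<le> ?S"
    \<comment> \<open>Two real levels \<open>c' < c\<close> are placed between \<open>?S\<close> and
      \<open>\<beta>star\<close>: \<open>c\<close> for the quotient with \<open>p n\<close>,
      \<open>c'\<close> for the one with \<open>q\<close>. The gap absorbs the approximation error,
      and the maximum with 0 makes both levels positive.\<close>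
    then have "max 0 ?S < \<beta>star" using \<open>\<beta>star > 0\<close> by simp
    then obtain c where c: "max 0 ?S < ereal c" "ereal c < \<beta>star"
      using ereal_dense2 by blast
    obtain c' where c': "max 0 ?S < ereal c'" "ereal c' < ereal c"
      using ereal_dense2[OF c(1)] by blast
    have "0 < c'" "c' < c" using c' by auto
    let ?d = "real CARD('d)" and ?Q = "L2_norm \<Omega> q"
    have qL2: "q \<in> L2 \<Omega>" using q(1) by (simp add: L2_mean_zero_def)
    then have "?Q \<noteq> 0" using q(2) by (simp add: L2_norm_eq_0_iff nonzero_on_def)
    then have "0 < ?Q" using L2_norm_nonneg[of \<Omega> q] by linarith
    obtain p where pM: "\<And>n. p n \<in> M n" and lim: "(\<lambda>n. L2_norm \<Omega> (\<lambda>x. p n x - q x)) \<longlonglongrightarrow> 0"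
      using assms(11) q(1) unfolding asymptotically_dense_def by blast
    \<comment> \<open>The tolerance for the error \<open>e\<close> comes from solving
      \<open>c * (?Q - e) - ?d * e > c' * ?Q\<close> for \<open>e\<close>: the norm of
      \<open>p n\<close> may fall short of \<open>?Q\<close> by \<open>e\<close>, and the divergence
      term may change by \<open>?d * e\<close> per unit of the seminorm of \<open>v\<close>.\<close>
    have "0 < (c - c') * ?Q / (c + ?d)"
      using \<open>0 < ?Q\<close> \<open>0 < c'\<close> \<open>c' < c\<close> by (intro divide_pos_pos mult_pos_pos) auto
    from order_tendstoD(2)[OF lim this] obtain n
      where "L2_norm \<Omega> (\<lambda>x. p n x - q x) < (c - c') * ?Q / (c + ?d)"
      by (auto simp: eventually_sequentially)
    moreover define e where "e = L2_norm \<Omega> (\<lambda>x. p n x - q x)"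
    ultimately have e: "e * (c + ?d) < (c - c') * ?Q"
      using \<open>0 < c'\<close> \<open>c' < c\<close> by (simp add: pos_less_divide_eq)
    have "0 \<le> e" by (simp add: e_def L2_norm_nonneg)
    have pL2: "p n \<in> L2 \<Omega>" using pM assms(7) by (auto simp: L2_mean_zero_def)
    have tri: "?Q \<le> L2_norm \<Omega> (p n) + e"
      unfolding e_def by (rule L2_norm_triangle[OF pL2 qL2])
    \<comment> \<open>The discrete infimum only sees nonzero elements. If \<open>p n\<close> had
      norm 0, then \<open>?Q \<le> e\<close>, hence
      \<open>e * (c + ?d) \<ge> c * ?Q > (c - c') * ?Q\<close>, against the tolerance.\<close>
    have "0 < L2_norm \<Omega> (p n)"
    proof (rule ccontr)
      assume "\<not> 0 < L2_norm \<Omega> (p n)"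
      then have "?Q * c \<le> e * c" using tri \<open>0 < c'\<close> \<open>c' < c\<close> by (intro mult_right_mono) auto
      moreover have "0 < c' * ?Q" "0 \<le> e * ?d" using \<open>0 < c'\<close> \<open>0 < ?Q\<close> \<open>0 \<le> e\<close> by simp_all
      ultimately show False using e by (simp add: algebra_simps)
    qed
    then have "p n \<in> {q \<in> M n. nonzero_on \<Omega> q}"
      using pM L2_norm_eq_0_iff[OF pL2] by (auto simp: nonzero_on_def)
    then have "inf_sup_const \<Omega> (X n) (M n) \<le> (SUP v\<in>{v \<in> X n. nonzero_on \<Omega> v}.
        ereal (L2_inner \<Omega> (weak_div \<Omega> v) (p n) / (H1_seminorm_vec \<Omega> v * L2_norm \<Omega> (p n))))"
      unfolding inf_sup_const_def by (rule INF_lower)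
    moreover have "\<beta>star \<le> inf_sup_const \<Omega> (X n) (M n)"
      unfolding assms(9)[symmetric] by (rule INF_lower) simp
    \<comment> \<open>Since \<open>c\<close> lies strictly below the supremum, some \<open>v\<close>
      exceeds it, whether or not the supremum is attained.\<close>
    ultimately obtain v where v: "v \<in> X n" "nonzero_on \<Omega> v"
      and big: "c < L2_inner \<Omega> (weak_div \<Omega> v) (p n) / (H1_seminorm_vec \<Omega> v * L2_norm \<Omega> (p n))"
      using less_le_trans[OF less_le_trans[OF c(2)]] by (fastforce simp: less_SUP_iff)
    have vH: "v \<in> H1_0_vec \<Omega>" using v(1) assms(5) by blast
    let ?V = "H1_seminorm_vec \<Omega> v"
    have "?V \<noteq> 0"
      \<comment> \<open>otherwise the quotient in \<open>big\<close> is \<open>0\<close>\<close>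
      using big \<open>0 < c'\<close> \<open>c' < c\<close> by auto
    then have "0 < ?V" using H1_seminorm_vec_nonneg[of \<Omega> v] by linarith
    have p_bound: "c * (?V * L2_norm \<Omega> (p n)) \<le> L2_inner \<Omega> (weak_div \<Omega> v) (p n)"
      using big \<open>0 < ?V\<close> \<open>0 < L2_norm \<Omega> (p n)\<close> by (simp add: pos_less_divide_eq)
    \<comment> \<open>Exchanging \<open>p n\<close> for \<open>q\<close> costs exactly this term,
      which is at most \<open>?d * ?V * e\<close> in absolute value.\<close>
    have "L2_inner \<Omega> (weak_div \<Omega> v) (\<lambda>x. p n x - q x)
        = L2_inner \<Omega> (weak_div \<Omega> v) (p n) - L2_inner \<Omega> (weak_div \<Omega> v) q"
      using L2_inner_diff_left[OF pL2 qL2 weak_div_in_L2[OF vH]]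
      by (simp add: L2_inner_commute[of \<Omega> "weak_div \<Omega> v"])
    moreover have "\<bar>L2_inner \<Omega> (weak_div \<Omega> v) (\<lambda>x. p n x - q x)\<bar> \<le> ?d * ?V * e"
      unfolding e_def by (rule weak_div_inner_bound[OF vH L2_diff[OF pL2 qL2]])
    \<comment> \<open>Up to the positive factor \<open>?V\<close> this is the inequality that fixed
      the tolerance, with \<open>?Q - e\<close> as a lower bound for the norm of
      \<open>p n\<close>.\<close>
    moreover have "c' * (?V * ?Q) \<le> c * (?V * L2_norm \<Omega> (p n)) - ?d * ?V * e"
    proof -
      have "c * ?Q \<le> c * (L2_norm \<Omega> (p n) + e)"
        using tri \<open>0 < c'\<close> \<open>c' < c\<close> by (intro mult_left_mono) auto
      then have "c' * ?Q \<le> c * L2_norm \<Omega> (p n) - ?d * e"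
        using e by (simp add: algebra_simps)
      then have "?V * (c' * ?Q) \<le> ?V * (c * L2_norm \<Omega> (p n) - ?d * e)"
        using \<open>0 < ?V\<close> by (intro mult_left_mono) auto
      then show ?thesis by (simp add: algebra_simps)
    qed
    ultimately have "c' * (?V * ?Q) \<le> L2_inner \<Omega> (weak_div \<Omega> v) q"
      using p_bound by linarith
    then have "ereal c' \<le> ereal (L2_inner \<Omega> (weak_div \<Omega> v) q / (?V * ?Q))"
      using \<open>0 < ?V\<close> \<open>0 < ?Q\<close> by (simp add: pos_le_divide_eq)
    \<comment> \<open>As \<open>X n\<close> lies in \<open>H1_0_vec \<Omega>\<close>, the discrete
      \<open>v\<close> competes in the full supremum, which forces
      \<open>c' \<le> ?S\<close>.\<close>
    also have "\<dots> \<le> ?S"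
      using vH v(2) by (intro SUP_upper) auto
    finally show False using c'(1) by (meson leD max_less_iff_conj)
  qed
  then show ?thesis
    unfolding LBB_const_def inf_sup_const_def by (intro INF_greatest) auto
qed

end
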